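(* Let $(X,d)$ be a compact metric space and let $\phi:X\to X$ be a continuous relation. Then: (i) $X$ is a physical attractor for $\phi$ if and only if $\phi$ is topologically mixing. (ii) If $X$ is an attractor for $\phi$, then $X$ is a physical attractor for $\phi$. (iii) If $X$ is an attractor for $\phi$, then $X$ is a proper attractor for $\phi$. (iv) If $X$ is an attractor for $\phi$, then $\phi$ is equicontinuous, i.e. $\mathrm{Eq}(\phi)=X$. (v) If $X$ is an attractor for $\phi$, then $\phi^{-1}$ is topologically exact; conversely, if $\phi^{-1}$ is topologically exact, then $X$ is an attractor for $\phi$. (vi) If $X$ is an attractor for $\phi$, then for every $\epsilon>0$ there exists $n_\dagger\in\mathbb{N}$ such that $d_H(\phi^i(x),X)<\epsilon$ for every $i>n_\dagger$ and every $x\in X$.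
   Context: Relations. A relation $\phi:X\to X$ is a subset of $X\times X$; $\phi(x)=\{y:(x,y)\in\phi\}$, $\phi(A)=\bigcup_{a\in A}\phi(a)$ for $A\subset X$, and $\phi^{-1}=\{(y,x):(x,y)\in\phi\}$. The composition $\psi\circ\phi$ is $\{(x,z): \exists y,\ (x,y)\in\phi,\ (y,z)\in\psi\}$; $\phi^0=\mathrm{id}_X$, $\phi^{n+1}=\phi\circ\phi^n$, and $\phi^{-n}=(\phi^{-1})^n$. The relation $\phi$ is closed (upper semi-continuous) if it is a closed subset of $X\times X$ (so $\phi^{-1}(B)$ is closed for every closed $B\subset X$); it is lower semi-continuous if $\phi^{-1}(B)$ is open for every open $B\subset X$; it is continuous if it is both. $d_H$ is the Hausdorff metric on the space $\mathcal{K}(X)$ of non-empty compact subsets of $X$. A statement such as $d_H(\phi^i(K),X)\to0$ or $d_H(\phi^i(x),X)<\epsilon$ includes the assertion that the sets involved are non-empty (in the case of the limit, for all large $i$). Attractors. $X$ is an attractor for $\phi$ if $d_H(\phi^i(K),X)\to 0$ as $i\to\infty$ for every non-empty compact $K\subset X$. $X$ is a physical attractor for $\phi$ if for every non-empty open $U\subset X$ there is a compact set $K\subset U$ with $d_H(\phi^i(K),X)\to 0$ as $i\to\infty$. For a family $\{B_n\}_{n\in\mathbb{N}}$ of non-empty subsets of $X$, $\mathrm{Ls}^*B_n$ is the collection of all non-empty proper compact subsets $K\subsetneq X$ such that for every pair of disjoint open sets $U,V$ with $U\supset K$, the set $\{i\in\mathbb{N}: \text{ for some } j\in\mathbb{N},\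 U\cap\phi^i(B_j)\neq\emptyset \text{ and } V\cap\phi^i(B_j)=\emptyset\}$ is infinite, where $V$ ranges over non-empty open sets. $X$ is a proper attractor for $\phi$ if $X$ is an attractor for $\phi$ and $\mathrm{Ls}^*B_n=\emptyset$ for every family $\{B_n\}_{n\in\mathbb{N}}$ of non-empty subsets of $X$. Equicontinuity. Put $d_\phi(x_1,x_2)=\sup_{n\in\mathbb{N}}d_H(\phi^n(x_1),\phi^n(x_2))$. A point $x\in X$ is equicontinuous if $\mathrm{id}_X:(X,d)\to(X,d_\phi)$ is continuous at $x$; $\mathrm{Eq}(\phi)$ is the set of such points, and $\phi$ is equicontinuous if $\mathrm{Eq}(\phi)=X$. Exactness and mixing. A relation $\psi$ on $X$ is topologically exact if for every non-empty open $W\subset X$ there is $j\in\mathbb{N}$, $j\ge1$, with $\psi^j(W)=X$. It is topologically mixing if for all non-empty open $W,V\subset X$ there is $J\in\mathbb{N}$ with $\psi^j(W)\cap V\ne\emptyset$ for every $j\ge J$. *)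

theory Defs
  imports "HOL-Analysis.Analysis"
begin

text \<open>
  Relations on a space are sets of pairs. The image \<open>\<phi>(A)\<close> is \<open>\<phi> `` A\<close>, the iterate \<open>\<phi>\<^sup>n\<close> is
  \<open>\<phi> ^^ n\<close> (with \<open>\<phi> ^^ 0 = Id\<close>), and \<open>\<phi>\<^sup>-\<^sup>1\<close> is \<open>\<phi>\<inverse>\<close>. Natural numbers start at 0.
\<close>

definition lower_semicontinuous_rel :: "'a::topological_space rel \<Rightarrow> bool" where
  "lower_semicontinuous_rel \<phi> \<longleftrightarrow> (\<forall>B. open B \<longrightarrow> open (\<phi>\<inverse> `` B))"

definition continuous_rel :: "'a::topological_space rel \<Rightarrow> bool" where
  "continuous_rel \<phi> \<longleftrightarrow> closed \<phi> \<and> lower_semicontinuous_rel \<phi>"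

text \<open>
  The Hausdorff distance is only meaningful for non-empty bounded sets; on the empty set the
  value is unspecified. Every definition below that bounds it therefore carries an explicit
  non-emptiness condition.
\<close>

definition hausdorff_dist :: "'a::metric_space set \<Rightarrow> 'a set \<Rightarrow> real" where
  "hausdorff_dist A B = max (SUP a\<in>A. infdist a B) (SUP b\<in>B. infdist b A)"

definition iterates_fill :: "'a::metric_space rel \<Rightarrow> 'a set \<Rightarrow> bool" where
  "iterates_fill \<phi> K \<longleftrightarrow>
     (\<forall>\<^sub>F i in sequentially. (\<phi> ^^ i) `` K \<noteq> {}) \<and>
     (\<lambda>i. hausdorff_dist ((\<phi> ^^ i) `` K) UNIV) \<longlonglongrightarrow> 0"

definition attractor :: "'a::metric_space rel \<Rightarrow> bool" where
  "attractor \<phi> \<longleftrightarrow> (\<forall>K. compact K \<and> K \<noteq> {} \<longrightarrow> iterates_fill \<phi> K)"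

definition physical_attractor :: "'a::metric_space rel \<Rightarrow> bool" where
  "physical_attractor \<phi> \<longleftrightarrow>
     (\<forall>U. open U \<and> U \<noteq> {} \<longrightarrow>
        (\<exists>K. compact K \<and> K \<noteq> {} \<and> K \<subseteq> U \<and> iterates_fill \<phi> K))"

definition Ls_star :: "'a::topological_space rel \<Rightarrow> (nat \<Rightarrow> 'a set) \<Rightarrow> 'a set set" where
  "Ls_star \<phi> B =
     {K. compact K \<and> K \<noteq> {} \<and> K \<noteq> UNIV \<and>
         (\<forall>U V. open U \<and> open V \<and> V \<noteq> {} \<and> U \<inter> V = {} \<and> K \<subseteq> U \<longrightarrow>
            infinite {i. \<exists>j. U \<inter> (\<phi> ^^ i) `` B j \<noteq> {} \<and> V \<inter> (\<phi> ^^ i) `` B j = {}})}"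

definition proper_attractor :: "'a::metric_space rel \<Rightarrow> bool" where
  "proper_attractor \<phi> \<longleftrightarrow>
     attractor \<phi> \<and> (\<forall>B. (\<forall>n. B n \<noteq> {}) \<longrightarrow> Ls_star \<phi> B = {})"

definition orbit_dist :: "'a::metric_space rel \<Rightarrow> 'a \<Rightarrow> 'a \<Rightarrow> real" where
  "orbit_dist \<phi> x y = (SUP n. hausdorff_dist ((\<phi> ^^ n) `` {x}) ((\<phi> ^^ n) `` {y}))"

text \<open>
  Continuity at \<open>x\<close> of the identity from \<open>(X, d)\<close> to \<open>(X, d\<^sub>\<phi>)\<close>, where \<open>d\<^sub>\<phi>\<close> is \<open>orbit_dist \<phi>\<close>;
  a bound on \<open>d\<^sub>\<phi>(x, y)\<close> includes that all iterates of \<open>x\<close> and \<open>y\<close> are non-empty.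
\<close>

definition Eq_points :: "'a::metric_space rel \<Rightarrow> 'a set" where
  "Eq_points \<phi> =
     {x. \<forall>\<epsilon>>0. \<exists>\<delta>>0. \<forall>y. dist x y < \<delta> \<longrightarrow>
           (\<forall>n. (\<phi> ^^ n) `` {x} \<noteq> {} \<and> (\<phi> ^^ n) `` {y} \<noteq> {}) \<and> orbit_dist \<phi> x y < \<epsilon>}"

definition equicontinuous_rel :: "'a::metric_space rel \<Rightarrow> bool" where
  "equicontinuous_rel \<phi> \<longleftrightarrow> Eq_points \<phi> = UNIV"

definition topologically_exact :: "'a::topological_space rel \<Rightarrow> bool" where
  "topologically_exact \<psi> \<longleftrightarrow>
     (\<forall>W. open W \<and> W \<noteq> {} \<longrightarrow> (\<exists>j\<ge>1. (\<psi> ^^ j) `` W = UNIV))"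

definition topologically_mixing :: "'a::topological_space rel \<Rightarrow> bool" where
  "topologically_mixing \<psi> \<longleftrightarrow>
     (\<forall>W V. open W \<and> W \<noteq> {} \<and> open V \<and> V \<noteq> {} \<longrightarrow>
        (\<exists>J. \<forall>j\<ge>J. (\<psi> ^^ j) `` W \<inter> V \<noteq> {}))"

end

theory Submission
  imports Defs
begin

text \<open>
  Over a compact space, \<open>d\<^sub>H(\<phi>\<^sup>i(K), X) \<rightarrow> 0\<close> means that for every non-empty open \<open>W\<close> the sets
  \<open>\<phi>\<^sup>i(K)\<close> eventually meet \<open>W\<close>. Everything is reduced to the uniform version of this for points:
  for every \<open>W\<close> there is \<open>N\<close> such that \<open>\<phi>\<^sup>i(x)\<close> meets \<open>W\<close> for all \<open>x\<close> and all \<open>i \<ge> N\<close>.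

  Exactness of \<open>\<phi>\<inverse>\<close> gives this for one \<open>i\<close>, hence for all larger ones because \<open>\<phi>\<inverse>(X) = X\<close>.
  If \<open>X\<close> is an attractor, apply the Baire theorem to the closed sets
  \<open>{x. \<forall>i\<ge>N. \<phi>\<^sup>i(x) meets C}\<close>, where \<open>C \<subseteq> W\<close> is a closed ball: one of them contains a
  non-empty open set \<open>U\<close>, and finitely many of the open sets \<open>\<phi>\<^sup>-\<^sup>n(U)\<close> cover \<open>X\<close>.
\<close>

section \<open>Iterated relations\<close>

lemma converse_relpow:
  fixes R :: "'a rel"
  shows "(R ^^ n)\<inverse> = (R\<inverse>) ^^ n"
  by (induction n) (simp_all add: converse_relcomp relpow_commute)

lemma converse_Image_iff: "x \<in> R\<inverse> `` W \<longleftrightarrow> R `` {x} \<inter> W \<noteq> {}"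
  by auto

text \<open>The preimage is the first projection of the compact set
  \<open>\<phi> \<inter> (UNIV \<times> B)\<close>.\<close>

lemma closed_converse_Image:
  fixes \<phi> :: "'a::metric_space rel"
  assumes "compact (UNIV :: 'a set)" "closed \<phi>" "closed B"
  shows "closed (\<phi>\<inverse> `` B)"
proof -
  have "compact ((UNIV :: 'a set) \<times> (UNIV :: 'a set))"
    using assms by (intro compact_Times)
  then have "compact (\<phi> \<inter> (UNIV \<times> B))"
    using assms closed_Times[OF closed_UNIV \<open>closed B\<close>]
    by (metis UNIV_Times_UNIV closed_Int compact_Int_closed inf_top_left)
  then have "compact (fst ` (\<phi> \<inter> (UNIV \<times> B)))"
    by (intro compact_continuous_image continuous_intros)
  moreover have "fst ` (\<phi> \<inter> (UNIV \<times> B)) = \<phi>\<inverse> `` B"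
    by force
  ultimately show ?thesis
    by (simp add: compact_imp_closed)
qed

lemma closed_converse_relpow_Image:
  fixes \<phi> :: "'a::metric_space rel"
  assumes "compact (UNIV :: 'a set)" "closed \<phi>" "closed B"
  shows "closed ((\<phi> ^^ n)\<inverse> `` B)"
  using \<open>closed B\<close>
\<comment> \<open>The inductive step pulls \<open>B\<close> back along one factor
  \<open>\<phi>\<close> and applies the hypothesis to that preimage, so \<open>B\<close> has to
  vary.\<close>
proof (induction n arbitrary: B)
  case (Suc n)
  then show ?case
    using closed_converse_Image[OF assms(1,2)]
    by (simp add: converse_relcomp relcomp_Image)
qed simp

lemma open_converse_relpow_Image:
  fixes \<phi> :: "'a::topological_space rel"
  assumes "lower_semicontinuous_rel \<phi>" "open B"
  shows "open ((\<phi> ^^ n)\<inverse> `` B)"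
  using \<open>open B\<close>
proof (induction n arbitrary: B)
  case (Suc n)
  then show ?case
    using assms(1) by (simp add: converse_relcomp relcomp_Image lower_semicontinuous_rel_def)
qed simp

lemma relpow_Image_nonempty:
  fixes \<phi> :: "'a rel"
  assumes "\<And>x. \<phi> `` {x} \<noteq> {}"
  shows "(\<phi> ^^ n) `` {x} \<noteq> {}"
proof (induction n)
  case (Suc n)
  then obtain y where "(x, y) \<in> \<phi> ^^ n" by auto
  moreover obtain z where "(y, z) \<in> \<phi>" using assms[of y] by auto
  ultimately show ?case by auto
qed simp

lemma Image_nonempty_of_relpow:
  fixes \<phi> :: "'a rel"
  assumes "n \<ge> 1" "(\<phi> ^^ n) `` {x} \<noteq> {}"
  shows "\<phi> `` {x} \<noteq> {}"
proof -
  obtain m where "n = Suc m" using \<open>n \<ge> 1\<close> by (cases n) auto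
  \<comment> \<open>Iterates unfold at the end; \<open>relpow_commute\<close> moves a factor
    \<open>\<phi>\<close> to the front, where it is the first step from \<open>x\<close>.\<close>
  with assms(2) have "(\<phi> O \<phi> ^^ m) `` {x} \<noteq> {}"
    by (simp add: relpow_commute)
  then show ?thesis by auto
qed

section \<open>Hausdorff distance in a compact space\<close>

lemma hausdorff_dist_le:
  assumes "A \<noteq> {}" "B \<noteq> {}"
    and "\<And>a. a \<in> A \<Longrightarrow> infdist a B \<le> e" "\<And>b. b \<in> B \<Longrightarrow> infdist b A \<le> e"
  shows "hausdorff_dist A B \<le> e"
  unfolding hausdorff_dist_def using assms by (auto intro!: cSUP_least)

lemma hausdorff_dist_UNIV_nonneg: "A \<noteq> {} \<Longrightarrow> 0 \<le> hausdorff_dist A UNIV"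
  by (simp add: hausdorff_dist_def)

text \<open>Compactness bounds the continuous function \<open>\<lambda>b. infdist b A\<close>, so
  its supremum is a genuine upper bound.\<close>

lemma infdist_le_hausdorff_dist_UNIV:
  fixes A :: "'a::metric_space set"
  assumes "compact (UNIV :: 'a set)"
  shows "infdist b A \<le> hausdorff_dist A UNIV"
proof -
  have "compact ((\<lambda>b. infdist b A) ` UNIV)"
    using assms by (intro compact_continuous_image continuous_intros)
  then have "bdd_above (range (\<lambda>b. infdist b A))"
    by (simp add: bounded_imp_bdd_above compact_imp_bounded)
  then have "infdist b A \<le> (SUP b. infdist b A)"
    by (intro cSUP_upper) auto
  then show ?thesis
    by (simp add: hausdorff_dist_def)
qed

lemma finite_ball_cover:
  fixes e :: real
  assumes "compact (UNIV :: 'a::metric_space set)" "e > 0"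
  obtains F :: "'a::metric_space set" where "finite F" "\<And>x. \<exists>c\<in>F. dist c x < e"
proof -
  from assms obtain F :: "'a set" where "finite F" "UNIV \<subseteq> (\<Union>c\<in>F. ball c e)"
    unfolding compact_eq_totally_bounded by blast
  then show thesis
    by (intro that[of F]) (auto simp: subset_eq)
qed

text \<open>A centre \<open>c\<close> close to \<open>b\<close> is also close to some point of
  \<open>A\<close>; the two half radii add up to \<open>e\<close>.\<close>

lemma infdist_le_of_meets_balls:
  assumes "\<And>x. \<exists>c\<in>F. dist c x < e / 2" "\<And>c. c \<in> F \<Longrightarrow> A \<inter> ball c (e / 2) \<noteq> {}"
  shows "infdist b A \<le> e"
proof -
  obtain c where c: "c \<in> F" "dist c b < e / 2" using assms(1) by blast
  obtain a where a: "a \<in> A" "dist c a < e / 2" using assms(2)[OF c(1)] by auto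
  show ?thesis
    using dist_triangle[of b a c] a c by (intro infdist_le2[OF a(1)]) (simp add: dist_commute)
qed

text \<open>Turns Hausdorff convergence into a topological condition. Forward, a point of the image
  close to the centre of a ball inside \<open>W\<close> lies in \<open>W\<close>; backward, an image
  that meets finitely many small balls covering the space is close to every point.\<close>

lemma iterates_fill_iff:
  fixes \<phi> :: "'a::metric_space rel"
  assumes "compact (UNIV :: 'a set)"
  shows "iterates_fill \<phi> K \<longleftrightarrow>
    (\<forall>W. open W \<and> W \<noteq> {} \<longrightarrow> (\<forall>\<^sub>F i in sequentially. (\<phi> ^^ i) `` K \<inter> W \<noteq> {}))"
    (is "_ \<longleftrightarrow> ?meets")
proof
  assume fill: "iterates_fill \<phi> K"
  show ?meets
  proof (intro allI impI)
    fix W :: "'a set" assume W: "open W \<and> W \<noteq> {}"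
    then obtain w e where e: "e > 0" "ball w e \<subseteq> W"
      by (meson ex_in_conv openE)
    have "\<forall>\<^sub>F i in sequentially. hausdorff_dist ((\<phi> ^^ i) `` K) UNIV < e"
      using fill e(1) by (auto simp: iterates_fill_def intro: order_tendstoD)
    moreover have "\<forall>\<^sub>F i in sequentially. (\<phi> ^^ i) `` K \<noteq> {}"
      using fill by (simp add: iterates_fill_def)
    ultimately show "\<forall>\<^sub>F i in sequentially. (\<phi> ^^ i) `` K \<inter> W \<noteq> {}"
    proof eventually_elim
      case (elim i)
      then have "infdist w ((\<phi> ^^ i) `` K) < e"
        using infdist_le_hausdorff_dist_UNIV[OF assms, of w "(\<phi> ^^ i) `` K"] by linarith
      then obtain y where y: "y \<in> (\<phi> ^^ i) `` K" "dist w y < e"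
        using elim(2) by (auto simp: infdist_def cINF_less_iff)
      then have "y \<in> W" using e(2) by auto
      with y(1) show ?case by blast
    qed
  qed
next
  assume meets: ?meets
  have ne: "\<forall>\<^sub>F i in sequentially. (\<phi> ^^ i) `` K \<noteq> {}"
    using meets[rule_format, of UNIV] by simp
  have "(\<lambda>i. hausdorff_dist ((\<phi> ^^ i) `` K) UNIV) \<longlonglongrightarrow> 0"
  proof (rule tendstoI)
    fix e :: real assume "e > 0"
    \<comment> \<open>Quarter radii give the bound \<open>e / 2\<close>, which leaves room for the
      strict inequality.\<close>
    then obtain F :: "'a set" where F: "finite F" "\<And>x. \<exists>c\<in>F. dist c x < e / 2 / 2"
      using finite_ball_cover[OF assms, of "e / 2 / 2"] by auto
    have "\<forall>\<^sub>F i in sequentially. \<forall>c\<in>F. (\<phi> ^^ i) `` K \<inter> ball c (e / 2 / 2) \<noteq> {}"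
      using F(1) meets \<open>e > 0\<close> by (intro eventually_ball_finite ballI) auto
    with ne show "\<forall>\<^sub>F i in sequentially. dist (hausdorff_dist ((\<phi> ^^ i) `` K) UNIV) 0 < e"
    proof eventually_elim
      case (elim i)
      have "infdist b ((\<phi> ^^ i) `` K) \<le> e / 2" for b
        using infdist_le_of_meets_balls[OF F(2)] elim(2) by blast
      then have "hausdorff_dist ((\<phi> ^^ i) `` K) UNIV \<le> e / 2"
        using elim(1) \<open>e > 0\<close> by (intro hausdorff_dist_le) auto
      then show ?case
        using hausdorff_dist_UNIV_nonneg[OF elim(1)] \<open>e > 0\<close> by simp
    qed
  qed
  with ne show "iterates_fill \<phi> K" by (simp add: iterates_fill_def)
qed

text \<open>Serves for \<open>\<psi> = \<phi> ^^ n\<close> in the proof of equicontinuity. Closed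
  preimages keep the image of \<open>y\<close> near that of \<open>x\<close>; open preimages give
  the converse.\<close>

lemma hausdorff_continuous_at:
  fixes \<psi> :: "'a::metric_space rel"
  assumes compact: "compact (UNIV :: 'a set)"
    and closed: "\<And>B. closed B \<Longrightarrow> closed (\<psi>\<inverse> `` B)"
    and "open": "\<And>B. open B \<Longrightarrow> open (\<psi>\<inverse> `` B)"
    and ne: "\<And>x. \<psi> `` {x} \<noteq> {}"
    and "e > 0"
  shows "\<forall>\<^sub>F y in nhds x. hausdorff_dist (\<psi> `` {x}) (\<psi> `` {y}) \<le> e"
proof -
  \<comment> \<open>\<open>C\<close> collects the points too far from the image of \<open>x\<close>;
    near \<open>x\<close>, images avoid it because its preimage is closed and misses
    \<open>x\<close>.\<close>
  define C where "C = {z. e \<le> infdist z (\<psi> `` {x})}"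
  have "closed C"
    unfolding C_def by (intro closed_Collect_le continuous_intros)
  moreover have "x \<notin> \<psi>\<inverse> `` C"
    using \<open>e > 0\<close> by (auto simp: C_def)
  ultimately have upper: "\<forall>\<^sub>F y in nhds x. y \<in> - (\<psi>\<inverse> `` C)"
    using closed by (intro eventually_nhds_in_open) auto
  obtain F :: "'a set" where F: "finite F" "\<And>z. \<exists>c\<in>F. dist c z < e / 2"
    using finite_ball_cover[OF compact, of "e / 2"] \<open>e > 0\<close> by auto
  \<comment> \<open>Every point of the image of \<open>x\<close> lies in one of the finitely many
    balls that this image meets, and nearby images still meet all of these.\<close>
  have "\<forall>\<^sub>F y in nhds x. \<forall>c\<in>{c\<in>F. x \<in> \<psi>\<inverse> `` ball c (e / 2)}. y \<in> \<psi>\<inverse> `` ball c (e / 2)"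
    using F(1) "open" by (intro eventually_ball_finite ballI eventually_nhds_in_open) auto
  with upper show ?thesis
  proof eventually_elim
    case (elim y)
    have "infdist a (\<psi> `` {y}) \<le> e" if a: "a \<in> \<psi> `` {x}" for a
    proof -
      obtain c where c: "c \<in> F" "dist c a < e / 2" using F(2) by blast
      then have "x \<in> \<psi>\<inverse> `` ball c (e / 2)" using a by auto
      with c elim(2) have "y \<in> \<psi>\<inverse> `` ball c (e / 2)" by blast
      then obtain b where b: "b \<in> \<psi> `` {y}" "dist c b < e / 2" by auto
      show ?thesis
        using dist_triangle[of a b c] b c by (intro infdist_le2[OF b(1)]) (simp add: dist_commute)
    qed
    moreover have "infdist b (\<psi> `` {x}) \<le> e" if "b \<in> \<psi> `` {y}" for b
    proof -
      have "b \<notin> C" using elim(1) that by auto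
      then show ?thesis by (simp add: C_def)
    qed
    ultimately show ?case using ne by (intro hausdorff_dist_le)
  qed
qed

section \<open>Relations whose iterates fill the space uniformly\<close>

text \<open>Phrased with open sets instead of a metric, so that the link with exactness holds in
  every topological space.\<close>

definition fills_uniformly :: "'a::topological_space rel \<Rightarrow> bool" where
  "fills_uniformly \<phi> \<longleftrightarrow>
     (\<forall>W. open W \<and> W \<noteq> {} \<longrightarrow> (\<exists>N. \<forall>i\<ge>N. \<forall>x. (\<phi> ^^ i) `` {x} \<inter> W \<noteq> {}))"

lemma fills_uniformlyD:
  fixes \<phi> :: "'a::topological_space rel"
  assumes "fills_uniformly \<phi>" "open W" "W \<noteq> {}"
  obtains N where "\<And>i x. i \<ge> N \<Longrightarrow> (\<phi> ^^ i) `` {x} \<inter> W \<noteq> {}"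
proof -
  have "\<exists>N. \<forall>i\<ge>N. \<forall>x. (\<phi> ^^ i) `` {x} \<inter> W \<noteq> {}"
    using assms unfolding fills_uniformly_def by simp
  then obtain N where "\<forall>i\<ge>N. \<forall>x. (\<phi> ^^ i) `` {x} \<inter> W \<noteq> {}" ..
  then show thesis by (intro that[of N]) simp
qed

text \<open>Late images are non-empty, so every point has a first step, and the early iterates
  follow from this.\<close>

lemma fills_uniformly_nonempty:
  fixes \<phi> :: "'a::topological_space rel"
  assumes "fills_uniformly \<phi>"
  shows "(\<phi> ^^ n) `` {x} \<noteq> {}"
proof (rule relpow_Image_nonempty)
  fix x
  obtain N where N: "\<And>i x. i \<ge> N \<Longrightarrow> (\<phi> ^^ i) `` {x} \<inter> UNIV \<noteq> {}"
    using fills_uniformlyD[OF assms open_UNIV UNIV_not_empty] by blast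
  \<comment> \<open>\<open>N\<close> may be 0, and the zeroth iterate \<open>Id\<close> says nothing
    about \<open>\<phi>\<close>.\<close>
  have "(\<phi> ^^ Suc N) `` {x} \<noteq> {}"
    using N[of "Suc N" x] by simp
  then show "\<phi> `` {x} \<noteq> {}"
    by (rule Image_nonempty_of_relpow[rotated]) simp
qed

lemma topologically_exact_converse_iff:
  fixes \<phi> :: "'a::topological_space rel"
  shows "topologically_exact (\<phi>\<inverse>) \<longleftrightarrow> fills_uniformly \<phi>"
proof
  assume fill: "fills_uniformly \<phi>"
  show "topologically_exact (\<phi>\<inverse>)"
    unfolding topologically_exact_def
  proof (intro allI impI)
    fix W :: "'a set" assume "open W \<and> W \<noteq> {}"
    then obtain N where "\<And>i x. i \<ge> N \<Longrightarrow> (\<phi> ^^ i) `` {x} \<inter> W \<noteq> {}"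
      using fills_uniformlyD[OF fill] by blast
    \<comment> \<open>\<open>Suc N\<close> secures the requirement \<open>j \<ge> 1\<close> of
      exactness.\<close>
    then have "x \<in> (\<phi> ^^ Suc N)\<inverse> `` W" for x
      unfolding converse_Image_iff by (meson le_SucI order_refl)
    then have "(\<phi>\<inverse> ^^ Suc N) `` W = UNIV"
      unfolding converse_relpow by blast
    then show "\<exists>j\<ge>1. (\<phi>\<inverse> ^^ j) `` W = UNIV"
      by (intro exI[of _ "Suc N"]) simp
  qed
next
  assume exact: "topologically_exact (\<phi>\<inverse>)"
  have ex: "\<exists>j\<ge>1. \<forall>x. (\<phi> ^^ j) `` {x} \<inter> W \<noteq> {}" if W: "open W" "W \<noteq> {}" for W
  proof -
    obtain j where "j \<ge> 1" "(\<phi>\<inverse> ^^ j) `` W = UNIV"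
      using exact W unfolding topologically_exact_def by blast
    then have "x \<in> (\<phi> ^^ j)\<inverse> `` W" for x
      by (simp add: converse_relpow)
    then show ?thesis
      using \<open>j \<ge> 1\<close> unfolding converse_Image_iff by blast
  qed
  obtain j where "j \<ge> 1" "\<forall>x. (\<phi> ^^ j) `` {x} \<inter> UNIV \<noteq> {}"
    using ex[OF open_UNIV UNIV_not_empty] by blast
  then have "\<phi> `` {x} \<noteq> {}" for x
    using Image_nonempty_of_relpow[of j \<phi> x] by blast
  then have ne: "(\<phi> ^^ n) `` {x} \<noteq> {}" for n x
    by (rule relpow_Image_nonempty)
  show "fills_uniformly \<phi>"
    unfolding fills_uniformly_def
  proof (intro allI impI)
    fix W :: "'a set" assume "open W \<and> W \<noteq> {}"
    then obtain j where j: "\<And>x. (\<phi> ^^ j) `` {x} \<inter> W \<noteq> {}"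
      using ex by blast
    have "(\<phi> ^^ i) `` {x} \<inter> W \<noteq> {}" if "i \<ge> j" for i x
    proof -
      \<comment> \<open>The first \<open>i - j\<close> steps may end anywhere, since
        \<open>W\<close> can be reached from every point in exactly \<open>j\<close> more.\<close>
      obtain y where y: "(x, y) \<in> \<phi> ^^ (i - j)" using ne[of "i - j" x] by auto
      obtain w where w: "w \<in> W" "(y, w) \<in> \<phi> ^^ j" using j[of y] by auto
      have "(x, w) \<in> \<phi> ^^ (i - j + j)"
        unfolding relpow_add using y w by blast
      with w that show ?thesis by auto
    qed
    then show "\<exists>N. \<forall>i\<ge>N. \<forall>x. (\<phi> ^^ i) `` {x} \<inter> W \<noteq> {}" by blast
  qed
qed

section \<open>Attractors as uniformly filling relations\<close>

lemma attractor_imp_fills_uniformly: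
  fixes \<phi> :: "'a::metric_space rel"
  assumes compact: "compact (UNIV :: 'a set)" and cont: "continuous_rel \<phi>"
    and attr: "attractor \<phi>"
  shows "fills_uniformly \<phi>"
  unfolding fills_uniformly_def
proof (intro allI impI)
  fix W :: "'a set" assume W: "open W \<and> W \<noteq> {}"
  have evt: "\<forall>\<^sub>F i in sequentially. (\<phi> ^^ i) `` {x} \<inter> V \<noteq> {}" if "open V" "V \<noteq> {}" for x V
    using attr that unfolding attractor_def iterates_fill_iff[OF compact] by simp
  \<comment> \<open>The closed ball has closed preimages; the open ball with the same centre and
    radius is the target for the attractor property.\<close>
  obtain w e where e: "e > 0" "cball w e \<subseteq> W"
    using W by (meson ex_in_conv open_contains_cball)
  define C where "C N = (\<Inter>i\<in>{N..}. (\<phi> ^^ i)\<inverse> `` cball w e)" for N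
  have C_iff: "x \<in> C N \<longleftrightarrow> (\<forall>i\<ge>N. (\<phi> ^^ i) `` {x} \<inter> cball w e \<noteq> {})" for x N
    unfolding C_def INT_iff converse_Image_iff by (simp add: Ball_def)
  have closed_C: "closed (C N)" for N
    unfolding C_def using cont compact
    by (intro closed_INT ballI closed_converse_relpow_Image) (auto simp: continuous_rel_def)
  have "x \<in> (\<Union>N. C N)" for x
  proof -
    have "\<forall>\<^sub>F i in sequentially. (\<phi> ^^ i) `` {x} \<inter> ball w e \<noteq> {}"
      using e(1) by (intro evt) auto
    then obtain N where "\<And>i. i \<ge> N \<Longrightarrow> (\<phi> ^^ i) `` {x} \<inter> ball w e \<noteq> {}"
      by (auto simp: eventually_sequentially)
    then have "x \<in> C N"
      unfolding C_iff using ball_subset_cball by blast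
    then show ?thesis by blast
  qed
  then have "(\<Union>N. C N) = UNIV" by blast
  \<comment> \<open>Baire in contrapositive form: if every \<open>C N\<close> had empty interior, so
    would their union, which is the whole space. A compact Hausdorff space is locally compact and
    regular, as the theorem requires.\<close>
  moreover have "euclidean interior_of \<Union>(range C) = {}" if "\<And>N. interior (C N) = {}"
  proof (rule Baire_category_alt)
    have "compact_space (euclidean :: 'a topology)"
      using compact by (simp add: compact_space_def)
    then show "completely_metrizable_space (euclidean :: 'a topology)
        \<or> locally_compact_space (euclidean :: 'a topology) \<and> regular_space (euclidean :: 'a topology)"
      by (simp add: compact_imp_locally_compact_space compact_Hausdorff_or_regular_imp_normal_space
          compact_Hausdorff_imp_regular_space)
  qed (use closed_C that in auto)
  ultimately obtain N where N: "interior (C N) \<noteq> {}"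
    by (metis interior_UNIV UNIV_not_empty euclidean_interior_of)
  define U where "U = interior (C N)"
  have cover: "UNIV \<subseteq> (\<Union>n\<in>UNIV. (\<phi> ^^ n)\<inverse> `` U)"
  proof
    fix x
    have "\<forall>\<^sub>F i in sequentially. (\<phi> ^^ i) `` {x} \<inter> U \<noteq> {}"
      using N by (intro evt) (auto simp: U_def)
    then obtain n where "(\<phi> ^^ n) `` {x} \<inter> U \<noteq> {}"
      unfolding eventually_sequentially by blast
    then show "x \<in> (\<Union>n\<in>UNIV. (\<phi> ^^ n)\<inverse> `` U)"
      unfolding UN_iff converse_Image_iff by blast
  qed
  have open_preimage: "open ((\<phi> ^^ n)\<inverse> `` U)" for n
    using cont by (intro open_converse_relpow_Image) (auto simp: continuous_rel_def U_def)
  obtain I where I: "finite I" "UNIV \<subseteq> (\<Union>n\<in>I. (\<phi> ^^ n)\<inverse> `` U)"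
    by (rule compactE_image[OF compact open_preimage cover])
  \<comment> \<open>\<open>Max I\<close> bounds the time \<open>n\<close> at which \<open>U\<close>
    is reached, so at least \<open>N\<close> steps remain, and from \<open>U \<subseteq> C N\<close>
    they can end in the closed ball.\<close>
  have "(\<phi> ^^ i) `` {x} \<inter> W \<noteq> {}" if i: "i \<ge> N + Max I" for i x
  proof -
    obtain n where n: "n \<in> I" "x \<in> (\<phi> ^^ n)\<inverse> `` U" using I(2) by blast
    then obtain u where u: "u \<in> U" "(x, u) \<in> \<phi> ^^ n" by auto
    have "n \<le> Max I" using n I(1) by simp
    with i have le: "i - n \<ge> N" "n + (i - n) = i" by simp_all
    have "u \<in> C N" using u(1) interior_subset by (auto simp: U_def)
    then have "(\<phi> ^^ (i - n)) `` {u} \<inter> cball w e \<noteq> {}"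
      using le(1) by (simp add: C_iff)
    then obtain z where z: "z \<in> cball w e" "(u, z) \<in> \<phi> ^^ (i - n)" by auto
    have "(x, z) \<in> \<phi> ^^ (n + (i - n))"
      unfolding relpow_add using u z by blast
    with z e(2) le(2) show ?thesis by auto
  qed
  then show "\<exists>N. \<forall>i\<ge>N. \<forall>x. (\<phi> ^^ i) `` {x} \<inter> W \<noteq> {}" by blast
qed

lemma fills_uniformly_imp_attractor:
  fixes \<phi> :: "'a::metric_space rel"
  assumes compact: "compact (UNIV :: 'a set)" and fill: "fills_uniformly \<phi>"
  shows "attractor \<phi>"
  unfolding attractor_def iterates_fill_iff[OF compact]
proof (intro allI impI)
  fix K W :: "'a set" assume K: "compact K \<and> K \<noteq> {}" and W: "open W \<and> W \<noteq> {}"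
  obtain N where N: "\<And>i x. i \<ge> N \<Longrightarrow> (\<phi> ^^ i) `` {x} \<inter> W \<noteq> {}"
    using fills_uniformlyD[OF fill] W by blast
  obtain x where "x \<in> K" using K by blast
  then show "\<forall>\<^sub>F i in sequentially. (\<phi> ^^ i) `` K \<inter> W \<noteq> {}"
    using N[of _ x] unfolding eventually_sequentially by blast
qed

text \<open>Metric form of uniform filling: finitely many balls of radius \<open>e / 2\<close> serve
  as \<open>W\<close> and share one threshold.\<close>

lemma fills_uniformly_infdist:
  fixes \<phi> :: "'a::metric_space rel" and e :: real
  assumes compact: "compact (UNIV :: 'a set)" and fill: "fills_uniformly \<phi>" and "e > 0"
  shows "\<forall>\<^sub>F i in sequentially. \<forall>x b. infdist b ((\<phi> ^^ i) `` {x}) \<le> e"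
proof -
  obtain F :: "'a set" where F: "finite F" "\<And>z. \<exists>c\<in>F. dist c z < e / 2"
    using finite_ball_cover[OF compact, of "e / 2"] \<open>e > 0\<close> by auto
  have "\<forall>\<^sub>F i in sequentially. \<forall>c\<in>F. \<forall>x. (\<phi> ^^ i) `` {x} \<inter> ball c (e / 2) \<noteq> {}"
    using F(1)
  proof (intro eventually_ball_finite ballI)
    fix c :: 'a
    have "open (ball c (e / 2))" "ball c (e / 2) \<noteq> {}" using \<open>e > 0\<close> by auto
    then show "\<forall>\<^sub>F i in sequentially. \<forall>x. (\<phi> ^^ i) `` {x} \<inter> ball c (e / 2) \<noteq> {}"
      using fill unfolding fills_uniformly_def eventually_sequentially by blast
  qed
  then show ?thesis
    by eventually_elim (use infdist_le_of_meets_balls[OF F(2)] in blast)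
qed

text \<open>At late times both images are nearly dense, hence close to each other whatever
  \<open>y\<close> is; the finitely many early times are handled by continuity of each iterate at
  \<open>x\<close>.\<close>

lemma fills_uniformly_imp_equicontinuous:
  fixes \<phi> :: "'a::metric_space rel"
  assumes compact: "compact (UNIV :: 'a set)" and cont: "continuous_rel \<phi>"
    and fill: "fills_uniformly \<phi>"
  shows "equicontinuous_rel \<phi>"
proof -
  note ne = fills_uniformly_nonempty[OF fill]
  have "\<exists>\<delta>>0. \<forall>y. dist x y < \<delta> \<longrightarrow> orbit_dist \<phi> x y < e" if "e > 0" for x and e :: real
  proof -
    \<comment> \<open>The supremum over all times preserves only weak bounds, so half of
      \<open>e\<close> is aimed at.\<close>
    have "e / 2 > 0" using that by simp
    obtain N where N: "\<And>i x b. i \<ge> N \<Longrightarrow> infdist b ((\<phi> ^^ i) `` {x}) \<le> e / 2"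
      using fills_uniformly_infdist[OF compact fill \<open>e / 2 > 0\<close>]
      by (auto simp: eventually_sequentially)
    have "\<forall>\<^sub>F y in nhds x. \<forall>n\<in>{..<N}.
        hausdorff_dist ((\<phi> ^^ n) `` {x}) ((\<phi> ^^ n) `` {y}) \<le> e / 2"
      using cont compact ne \<open>e / 2 > 0\<close>
      by (intro eventually_ball_finite ballI hausdorff_continuous_at closed_converse_relpow_Image
          open_converse_relpow_Image) (auto simp: continuous_rel_def)
    then obtain \<delta> where \<delta>: "\<delta> > 0" "\<And>y n. dist y x < \<delta> \<Longrightarrow> n < N \<Longrightarrow>
        hausdorff_dist ((\<phi> ^^ n) `` {x}) ((\<phi> ^^ n) `` {y}) \<le> e / 2"
      unfolding eventually_nhds_metric by auto
    have "orbit_dist \<phi> x y < e" if y: "dist x y < \<delta>" for y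
    proof -
      have "hausdorff_dist ((\<phi> ^^ n) `` {x}) ((\<phi> ^^ n) `` {y}) \<le> e / 2" for n
      proof (cases "n < N")
        case True
        then show ?thesis using \<delta>(2) y by (simp add: dist_commute)
      next
        case False
        then show ?thesis using N ne by (intro hausdorff_dist_le) auto
      qed
      then have "orbit_dist \<phi> x y \<le> e / 2"
        unfolding orbit_dist_def by (intro cSUP_least) auto
      with \<open>e > 0\<close> show ?thesis by simp
    qed
    with \<delta>(1) show ?thesis by blast
  qed
  with ne show ?thesis
    unfolding equicontinuous_rel_def Eq_points_def by auto
qed

text \<open>Take \<open>V\<close> away from \<open>K\<close>. From some time on, the image of any
  point meets \<open>V\<close>, hence so does that of each \<open>B j\<close>, with a threshold
  independent of \<open>j\<close>.\<close>

lemma fills_uniformly_imp_Ls_star_empty: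
  fixes \<phi> :: "'a::metric_space rel"
  assumes fill: "fills_uniformly \<phi>" and B: "\<And>n. B n \<noteq> {}"
  shows "Ls_star \<phi> B = {}"
proof (rule ccontr)
  assume "Ls_star \<phi> B \<noteq> {}"
  then obtain K where "K \<in> Ls_star \<phi> B" by blast
  then have K: "compact K" "K \<noteq> UNIV" and
    inf: "\<And>U V. open U \<Longrightarrow> open V \<Longrightarrow> V \<noteq> {} \<Longrightarrow> U \<inter> V = {} \<Longrightarrow> K \<subseteq> U \<Longrightarrow>
      infinite {i. \<exists>j. U \<inter> (\<phi> ^^ i) `` B j \<noteq> {} \<and> V \<inter> (\<phi> ^^ i) `` B j = {}}"
    unfolding Ls_star_def by simp_all
  obtain y where y: "y \<notin> K" using K(2) by blast
  then obtain e where e: "e > 0" "ball y e \<inter> K = {}"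
    using compact_imp_closed[OF K(1)] unfolding closed_def open_contains_ball by blast
  \<comment> \<open>The half radius keeps the closed ball inside \<open>ball y e\<close>, which
    avoids \<open>K\<close>.\<close>
  define U V where "U = - cball y (e / 2)" and "V = ball y (e / 2)"
  have V: "open V" "V \<noteq> {}" using e(1) by (auto simp: V_def)
  have "cball y (e / 2) \<subseteq> ball y e" using e(1) by auto
  then have "K \<subseteq> U" using e(2) by (auto simp: U_def)
  then have infinite: "infinite {i. \<exists>j. U \<inter> (\<phi> ^^ i) `` B j \<noteq> {} \<and> V \<inter> (\<phi> ^^ i) `` B j = {}}"
    using V by (intro inf) (auto simp: U_def V_def)
  obtain N where N: "\<And>i x. i \<ge> N \<Longrightarrow> (\<phi> ^^ i) `` {x} \<inter> V \<noteq> {}"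
    using fills_uniformlyD[OF fill V] by blast
  have "V \<inter> (\<phi> ^^ i) `` B j \<noteq> {}" if "i \<ge> N" for i j
    using N[OF that] B[of j] by blast
  then have "{i. \<exists>j. U \<inter> (\<phi> ^^ i) `` B j \<noteq> {} \<and> V \<inter> (\<phi> ^^ i) `` B j = {}} \<subseteq> {..<N}"
    by (auto simp: not_le[symmetric])
  with infinite show False using finite_subset by blast
qed

section \<open>Physical attractors\<close>

text \<open>Mixing is the filling condition for open sets in place of compact ones; a compact closed
  ball between an open ball and \<open>U\<close> links the two.\<close>

lemma physical_attractor_iff_mixing:
  fixes \<phi> :: "'a::metric_space rel"
  assumes compact: "compact (UNIV :: 'a set)"
  shows "physical_attractor \<phi> \<longleftrightarrow> topologically_mixing \<phi>"
proof
  assume phys: "physical_attractor \<phi>"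
  show "topologically_mixing \<phi>"
    unfolding topologically_mixing_def
  proof (intro allI impI)
    fix W V :: "'a set" assume WV: "open W \<and> W \<noteq> {} \<and> open V \<and> V \<noteq> {}"
    then obtain K where K: "K \<subseteq> W" "iterates_fill \<phi> K"
      using phys by (auto simp: physical_attractor_def)
    then have "\<forall>\<^sub>F i in sequentially. (\<phi> ^^ i) `` K \<inter> V \<noteq> {}"
      using WV by (simp add: iterates_fill_iff[OF compact])
    then show "\<exists>J. \<forall>j\<ge>J. (\<phi> ^^ j) `` W \<inter> V \<noteq> {}"
      using K(1) unfolding eventually_sequentially by blast
  qed
next
  assume mix: "topologically_mixing \<phi>"
  show "physical_attractor \<phi>"
    unfolding physical_attractor_def
  proof (intro allI impI)
    fix U :: "'a set" assume "open U \<and> U \<noteq> {}"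
    then obtain u e where e: "e > 0" "cball u e \<subseteq> U"
      by (meson ex_in_conv open_contains_cball)
    \<comment> \<open>The compact set is fixed before the target \<open>W\<close>; this ball works
      for all targets because it contains \<open>ball u e\<close>.\<close>
    have "compact (cball u e)"
      using compact_Int_closed[OF compact closed_cball] by simp
    moreover have "iterates_fill \<phi> (cball u e)"
      unfolding iterates_fill_iff[OF compact]
    proof (intro allI impI)
      fix W :: "'a set" assume "open W \<and> W \<noteq> {}"
      moreover have "open (ball u e)" "ball u e \<noteq> {}" using e(1) by auto
      ultimately obtain J where "\<forall>j\<ge>J. (\<phi> ^^ j) `` ball u e \<inter> W \<noteq> {}"
        using mix unfolding topologically_mixing_def by blast
      then show "\<forall>\<^sub>F i in sequentially. (\<phi> ^^ i) `` cball u e \<inter> W \<noteq> {}"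
        unfolding eventually_sequentially using ball_subset_cball[of u e] by blast
    qed
    ultimately show "\<exists>K. compact K \<and> K \<noteq> {} \<and> K \<subseteq> U \<and> iterates_fill \<phi> K"
      using e by (intro exI[of _ "cball u e"]) auto
  qed
qed

text \<open>A single point of \<open>U\<close> provides the compact set.\<close>

lemma attractor_imp_physical_attractor:
  fixes \<phi> :: "'a::metric_space rel"
  assumes "attractor \<phi>"
  shows "physical_attractor \<phi>"
  unfolding physical_attractor_def
proof (intro allI impI)
  fix U :: "'a set" assume "open U \<and> U \<noteq> {}"
  then obtain u where "u \<in> U" by blast
  then show "\<exists>K. compact K \<and> K \<noteq> {} \<and> K \<subseteq> U \<and> iterates_fill \<phi> K"
    using assms by (intro exI[of _ "{u}"]) (simp add: attractor_def)
qed

section \<open>Assembly of the six claims\<close>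

theorem theorem1:
  fixes \<phi> :: "('a::metric_space) rel"
  assumes compact_X: "compact (UNIV :: 'a set)"
    and continuous: "continuous_rel \<phi>"
  shows "(physical_attractor \<phi> \<longleftrightarrow> topologically_mixing \<phi>)
    \<and> (attractor \<phi> \<longrightarrow> physical_attractor \<phi>)
    \<and> (attractor \<phi> \<longrightarrow> proper_attractor \<phi>)
    \<and> (attractor \<phi> \<longrightarrow> equicontinuous_rel \<phi>)
    \<and> (attractor \<phi> \<longleftrightarrow> topologically_exact (\<phi>\<inverse>))
    \<and> (attractor \<phi> \<longrightarrow>
         (\<forall>\<epsilon>>0. \<exists>n. \<forall>i>n. \<forall>x.
            (\<phi> ^^ i) `` {x} \<noteq> {} \<and> hausdorff_dist ((\<phi> ^^ i) `` {x}) UNIV < \<epsilon>))"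
proof -
  have fill: "attractor \<phi> \<longleftrightarrow> fills_uniformly \<phi>"
    using attractor_imp_fills_uniformly[OF compact_X continuous]
      fills_uniformly_imp_attractor[OF compact_X] by blast
  have fill_uniform: "\<exists>n. \<forall>i>n. \<forall>x. (\<phi> ^^ i) `` {x} \<noteq> {} \<and> hausdorff_dist ((\<phi> ^^ i) `` {x}) UNIV < \<epsilon>"
    if f: "fills_uniformly \<phi>" and "\<epsilon> > 0" for \<epsilon> :: real
  proof -
    note ne = fills_uniformly_nonempty[OF f]
    obtain n where n: "\<And>i x b. i \<ge> n \<Longrightarrow> infdist b ((\<phi> ^^ i) `` {x}) \<le> \<epsilon> / 2"
      using fills_uniformly_infdist[OF compact_X f, of "\<epsilon> / 2"] \<open>\<epsilon> > 0\<close>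
      by (auto simp: eventually_sequentially)
    have "hausdorff_dist ((\<phi> ^^ i) `` {x}) UNIV < \<epsilon>" if "i > n" for i x
    proof -
      \<comment> \<open>Only distances to the image count here, since points of the image have
        distance 0 to the whole space.\<close>
      have "hausdorff_dist ((\<phi> ^^ i) `` {x}) UNIV \<le> \<epsilon> / 2"
        using n that ne \<open>\<epsilon> > 0\<close> by (intro hausdorff_dist_le) auto
      with \<open>\<epsilon> > 0\<close> show ?thesis by simp
    qed
    with ne show ?thesis by blast
  qed
  show ?thesis
  proof (intro conjI impI)
    show "physical_attractor \<phi> \<longleftrightarrow> topologically_mixing \<phi>"
      by (rule physical_attractor_iff_mixing[OF compact_X])
    show "attractor \<phi> \<longleftrightarrow> topologically_exact (\<phi>\<inverse>)"
      by (simp add: fill topologically_exact_converse_iff)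
  next
    assume attr: "attractor \<phi>"
    then have f: "fills_uniformly \<phi>" by (simp add: fill)
    show "physical_attractor \<phi>"
      by (rule attractor_imp_physical_attractor[OF attr])
    show "proper_attractor \<phi>"
      using attr fills_uniformly_imp_Ls_star_empty[OF f] by (simp add: proper_attractor_def)
    show "equicontinuous_rel \<phi>"
      by (rule fills_uniformly_imp_equicontinuous[OF compact_X continuous f])
    show "\<forall>\<epsilon>>0. \<exists>n. \<forall>i>n. \<forall>x.
        (\<phi> ^^ i) `` {x} \<noteq> {} \<and> hausdorff_dist ((\<phi> ^^ i) `` {x}) UNIV < \<epsilon>"
      using fill_uniform[OF f] by blast
  qed
qed

end
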